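(* Let $\Phi=[-B,B]^{d_1}$ and $\Psi=[-B,B]^{d-d_1}$ with a constant $B>0$, and for $\phi_k\in\Phi$, $\psi\in\Psi$ let $$p_{\phi_k,\psi}(\boldsymbol x\vert k)=(2\pi)^{-d/2}e^{-\frac12\|\boldsymbol x-(\phi_k,\psi)\|_2^2},\qquad \boldsymbol x\in\mathbb R^d,\ k\in\{1,\dots,K\}.$$ Let the true conditional distributions be $p^*_{X\vert k}=p_{\phi_k^*,\psi^*}(\cdot\vert k)$ with $\phi_k^*\in\Phi$ for all $k$ and $\psi^*\in\Psi$, let $S=\{(\boldsymbol x_i,y_i)\}_{i=1}^n$ be i.i.d. from $p^*_{X,Y}=p^*_{X\vert Y}p^*_Y$, and let $\hat p^{\mathrm{multi}}_{X\vert Y}$ be a maximizer of $\mathcal L_S(p_{X\vert Y})=\prod_{i=1}^n p_{X\vert Y}(\boldsymbol x_i\vert y_i)$ over $$\mathcal P^{\mathrm{multi}}_{X\vert Y}=\Big\{\textstyle\prod_{k=1}^K (p_{\phi_k,\psi}(\boldsymbol x\vert k))^{\mathbb I(y=k)}:\phi_1,\dots,\phi_K\in\Phi,\ \psi\in\Psi\Big\}.$$ Then for any $0<\delta\le1/2$, with probability at least $1-\delta$, $$\mathcal R_{\overline{\mathrm{TV}}}(\hat p^{\mathrm{multi}}_{X\vert Y})=\tilde{\mathcal O}\left(\sqrt{\frac{(K-1)d_1+d}{n}}\right).$$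
   Context: $\mathscr X=\mathbb R^d$, $\mathscr Y=\{1,\dots,K\}$, $d_1\le d$; $p_Y^*$ is a distribution on $\mathscr Y$; $(\phi_k,\psi)\in\mathbb R^d$ is the concatenation; $\mathbb I$ is the indicator function. Average TV error: $\mathcal R_{\overline{\mathrm{TV}}}(\hat p_{X\vert Y})=\mathbb E_{Y\sim p_Y^*}\left[\frac12\int_{\mathscr X}\left|\hat p_{X\vert Y}(\boldsymbol x\vert Y)-p^*_{X\vert Y}(\boldsymbol x\vert Y)\right|d\boldsymbol x\right]$. $\tilde{\mathcal O}(b)$ means bounded above by $b$ up to absolute constants and logarithmic factors: there are absolute constants $C,c>0$ such that the left-hand side is at most $C\,b\,(\log(2+n+K+d+B+1/\delta))^{c}$. *)

theory Defs
  imports "HOL-Probability.Probability"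
begin

text \<open>
  The constants of the final bound must not depend on the dimension, so the dimension has to be
  quantified inside the formula. Hence \<open>\<real>\<^sup>m\<close> is modelled by the extensional functions on
  \<open>{..<m}\<close>, i.e. by the space of the finite product measure below.
\<close>

definition lebesgue_Rn :: "nat \<Rightarrow> (nat \<Rightarrow> real) measure" where
  "lebesgue_Rn m = PiM {..<m} (\<lambda>_. lborel)"

definition box_Rn :: "nat \<Rightarrow> real \<Rightarrow> (nat \<Rightarrow> real) set" where
  "box_Rn m B = PiE {..<m} (\<lambda>_. {-B..B})"

definition concat_vec :: "nat \<Rightarrow> (nat \<Rightarrow> real) \<Rightarrow> (nat \<Rightarrow> real) \<Rightarrow> nat \<Rightarrow> real" where
  "concat_vec d1 \<phi> \<psi> = (\<lambda>j. if j < d1 then \<phi> j else \<psi> (j - d1))"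

definition gauss_density ::
  "nat \<Rightarrow> nat \<Rightarrow> (nat \<Rightarrow> real) \<Rightarrow> (nat \<Rightarrow> real) \<Rightarrow> (nat \<Rightarrow> real) \<Rightarrow> real" where
  "gauss_density d d1 \<phi> \<psi> x =
     (2 * pi) powr (- real d / 2) *
     exp (- (1/2) * (L2_set (\<lambda>j. x j - concat_vec d1 \<phi> \<psi> j) {..<d})\<^sup>2)"

text \<open>A conditional density \<open>p(x | y)\<close> is a function \<open>p x y\<close> with label \<open>y \<in> {1..K}\<close>.\<close>

type_synonym cond_density = "(nat \<Rightarrow> real) \<Rightarrow> nat \<Rightarrow> real"

definition P_multi :: "nat \<Rightarrow> nat \<Rightarrow> nat \<Rightarrow> real \<Rightarrow> cond_density set" where
  "P_multi d d1 K B =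
     {(\<lambda>x y. \<Prod>k\<in>{1..K}. gauss_density d d1 (\<phi> k) \<psi> x ^ of_bool (y = k)) | \<phi> \<psi>.
        (\<forall>k\<in>{1..K}. \<phi> k \<in> box_Rn d1 B) \<and> \<psi> \<in> box_Rn (d - d1) B}"

definition joint_law :: "nat \<Rightarrow> nat \<Rightarrow> nat pmf \<Rightarrow> cond_density \<Rightarrow> ((nat \<Rightarrow> real) \<times> nat) measure" where
  "joint_law d K pY p =
     density (lebesgue_Rn d \<Otimes>\<^sub>M count_space {1..K}) (\<lambda>(x, y). ennreal (p x y * pmf pY y))"

definition sample_law ::
  "nat \<Rightarrow> nat \<Rightarrow> nat \<Rightarrow> nat pmf \<Rightarrow> cond_density \<Rightarrow> (nat \<Rightarrow> (nat \<Rightarrow> real) \<times> nat) measure" where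
  "sample_law n d K pY p = PiM {..<n} (\<lambda>_. joint_law d K pY p)"

definition likelihood :: "nat \<Rightarrow> (nat \<Rightarrow> (nat \<Rightarrow> real) \<times> nat) \<Rightarrow> cond_density \<Rightarrow> real" where
  "likelihood n S p = (\<Prod>i<n. p (fst (S i)) (snd (S i)))"

definition avg_TV_error :: "nat \<Rightarrow> nat pmf \<Rightarrow> cond_density \<Rightarrow> cond_density \<Rightarrow> real" where
  "avg_TV_error d pY p q =
     measure_pmf.expectation pY (\<lambda>y. 1/2 * (\<integral>x. \<bar>p x y - q x y\<bar> \<partial>lebesgue_Rn d))"

end

theory Submission imports Defs begin

text \<open>
  The likelihood of the estimator is at least that of the truth, which is the least squares
  inequality \<open>\<Sum>\<^sub>i \<parallel>x\<^sub>i - \<nu>(y\<^sub>i)\<parallel>\<^sup>2 \<le> \<Sum>\<^sub>i \<parallel>x\<^sub>i - \<mu>(y\<^sub>i)\<parallel>\<^sup>2\<close> between estimated means \<open>\<nu>\<close> and true means \<open>\<mu>\<close>.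
  Expanding it, \<open>\<Sum>\<^sub>k n\<^sub>k \<parallel>\<nu>\<^sub>k - \<mu>\<^sub>k\<parallel>\<^sup>2\<close> is bounded by a linear functional of the noise: its \<open>K d1\<close>
  label-specific coordinates involve the sums over one label, the \<open>d - d1\<close> shared ones the sums over
  the whole sample. With high probability all these sums have size \<open>\<surd>(L m)\<close>, where \<open>m\<close> is the
  number of summands and \<open>L\<close> is logarithmic, which gives the bound \<open>8 L ((K - 1) d1 + d)\<close>.
  Moreover \<open>n p\<^sub>k \<le> 2 (n\<^sub>k + L)\<close>, so empirical label frequencies may be replaced by the true ones.
  Finally the total variation distance of two such Gaussians is at most \<open>min 1 (\<parallel>\<nu>\<^sub>k - \<mu>\<^sub>k\<parallel> / 2)\<close>, and
  Jensen's inequality bounds the square of the averaged distance.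

  Both probability estimates are Chernoff bounds: a score \<open>g\<close> of one observation with
  \<open>E (exp g) \<le> 1\<close> satisfies \<open>\<Sum>\<^sub>i g(x\<^sub>i, y\<^sub>i) < L\<close> outside an event of probability \<open>exp (- L)\<close>.
\<close>

declare One_nat_def [simp del] \<comment> \<open>otherwise \<open>{1..K}\<close> turns into \<open>{Suc 0..K}\<close>\<close>

section \<open>Gaussian densities on \<open>\<real>\<^sup>d\<close>\<close>

text \<open>The product form makes integrals factor over the coordinates;
  \<open>gauss_density_eq_normal_Rn\<close> identifies it with the closed form, the mean being
  \<open>concat_vec\<close>.\<close>

definition normal_Rn :: "nat \<Rightarrow> (nat \<Rightarrow> real) \<Rightarrow> (nat \<Rightarrow> real) \<Rightarrow> real" where
  "normal_Rn d m x = (\<Prod>j<d. normal_density (m j) 1 (x j))"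

lemma normal_Rn_eq:
  "normal_Rn d m x = (1 / sqrt (2 * pi)) ^ d * exp (- (1/2) * (\<Sum>j<d. (x j - m j)\<^sup>2))"
proof -
  have "normal_Rn d m x = (\<Prod>j<d. 1 / sqrt (2 * pi) * exp (- (x j - m j)\<^sup>2 / 2))"
    by (simp add: normal_Rn_def normal_density_def)
  also have "\<dots> = (1 / sqrt (2 * pi)) ^ d * exp (\<Sum>j<d. - (x j - m j)\<^sup>2 / 2)"
    by (simp only: prod.distrib exp_sum[OF finite_lessThan] prod_constant card_lessThan)
  also have "(\<Sum>j<d. - (x j - m j)\<^sup>2 / 2) = - (1/2) * (\<Sum>j<d. (x j - m j)\<^sup>2)"
    by (simp add: sum_distrib_left sum_negf sum_divide_distrib)
  finally show ?thesis .
qed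

lemma normal_Rn_nonneg [simp]: "0 \<le> normal_Rn d m x"
  by (simp add: normal_Rn_def prod_nonneg)

lemma gauss_density_eq_normal_Rn:
  "gauss_density d d1 \<phi> \<psi> x = normal_Rn d (concat_vec d1 \<phi> \<psi>) x"
proof -
  have "(2 * pi) powr (- real d / 2) = (1 / sqrt (2 * pi)) ^ d"
  proof -
    have "(2 * pi) powr (- real d / 2) = ((2 * pi) powr (- (1/2))) powr real d"
      by (simp add: powr_powr)
    also have "(2 * pi) powr (- (1/2)) = 1 / sqrt (2 * pi)"
      by (simp only: powr_minus_divide powr_half_sqrt[of "2 * pi"] mult_nonneg_nonneg pi_ge_zero
          zero_le_numeral)
    also have "\<dots> powr real d = \<dots> ^ d"
      by (rule powr_realpow) simp
    finally show ?thesis .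
  qed
  then show ?thesis
    by (simp add: gauss_density_def normal_Rn_eq L2_set_def sum_nonneg)
qed

interpretation lborel_product: product_sigma_finite "\<lambda>_::nat. lborel :: real measure"
  by standard

lemma sets_lebesgue_Rn [measurable_cong]: "sets (lebesgue_Rn d) = sets (PiM {..<d} (\<lambda>_. borel))"
  unfolding lebesgue_Rn_def by (intro sets_PiM_cong) auto

lemma measurable_normal_Rn [measurable]: "normal_Rn d m \<in> borel_measurable (lebesgue_Rn d)"
  unfolding normal_Rn_def by measurable

lemma sigma_finite_lebesgue_Rn: "sigma_finite_measure (lebesgue_Rn d)"
  unfolding lebesgue_Rn_def by (rule lborel_product.sigma_finite) simp

lemma integrable_normal_Rn [simp, intro]: "integrable (lebesgue_Rn d) (normal_Rn d m)"
  unfolding normal_Rn_def lebesgue_Rn_def by (rule lborel_product.product_integrable_prod) auto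

lemma integral_normal_Rn [simp]: "(\<integral>x. normal_Rn d m x \<partial>lebesgue_Rn d) = 1"
  unfolding normal_Rn_def lebesgue_Rn_def
  by (subst lborel_product.product_integral_prod) auto

lemma nn_integral_normal_Rn [simp]: "(\<integral>\<^sup>+x. ennreal (normal_Rn d m x) \<partial>lebesgue_Rn d) = 1"
  by (subst nn_integral_eq_integral) auto

text \<open>By the parallelogram identity the exponents split into a part free of \<open>x\<close>
  and a Gaussian exponent centred at the midpoint of the means, so the affinity integral can be read
  off.\<close>

lemma sqrt_normal_Rn_mult:
  "sqrt (normal_Rn d m x * normal_Rn d m' x) =
     exp (- (\<Sum>j<d. (m j - m' j)\<^sup>2) / 8) * normal_Rn d (\<lambda>j. (m j + m' j) / 2) x"
proof -
  have "(\<Sum>j<d. (x j - m j)\<^sup>2) + (\<Sum>j<d. (x j - m' j)\<^sup>2) =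
      2 * ((\<Sum>j<d. (m j - m' j)\<^sup>2) / 4 + (\<Sum>j<d. (x j - (m j + m' j) / 2)\<^sup>2))"
    unfolding sum.distrib[symmetric] sum_divide_distrib sum_distrib_left
    by (intro sum.cong refl) (simp add: power2_eq_square field_simps)
  then have "normal_Rn d m x * normal_Rn d m' x =
      (exp (- (\<Sum>j<d. (m j - m' j)\<^sup>2) / 8) * normal_Rn d (\<lambda>j. (m j + m' j) / 2) x)\<^sup>2"
    by (simp add: normal_Rn_eq power2_eq_square mult_exp_exp)
  then show ?thesis
    by (simp add: real_sqrt_unique)
qed

text \<open>Completing the square in coordinate \<open>j\<close>: an exponential tilt of a Gaussian
  only moves its mean, so the tilted function still integrates to 1.\<close>

lemma normal_Rn_tilt:
  assumes "j < d"
  shows "normal_Rn d m x * exp (t * (x j - m j) - t\<^sup>2 / 2) = normal_Rn d (m(j := m j + t)) x"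
proof -
  have "(\<Sum>i<d. (x i - (m(j := m j + t)) i)\<^sup>2) =
      (\<Sum>i<d. (x i - m i)\<^sup>2 + (if i = j then t\<^sup>2 - 2 * t * (x j - m j) else 0))"
    by (intro sum.cong refl) (simp add: power2_eq_square algebra_simps)
  also have "\<dots> = (\<Sum>i<d. (x i - m i)\<^sup>2) + (t\<^sup>2 - 2 * t * (x j - m j))"
    using assms by (simp add: sum.distrib)
  finally show ?thesis
    by (simp add: normal_Rn_eq mult_exp_exp algebra_simps diff_divide_distrib add_divide_distrib)
qed

text \<open>This trivial bound serves the rare labels, whose means may be estimated badly: their
  contribution is truncated instead of being measured by the distance of the means.\<close>

lemma integral_normal_Rn_diff_le_2:
  "(\<integral>x. \<bar>normal_Rn d m x - normal_Rn d m' x\<bar> \<partial>lebesgue_Rn d) \<le> 2"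
proof -
  have "(\<integral>x. \<bar>normal_Rn d m x - normal_Rn d m' x\<bar> \<partial>lebesgue_Rn d)
      \<le> (\<integral>x. normal_Rn d m x + normal_Rn d m' x \<partial>lebesgue_Rn d)"
    by (intro integral_mono integrable_abs Bochner_Integration.integrable_diff
          Bochner_Integration.integrable_add integrable_normal_Rn)
      (auto simp: abs_le_iff add_increasing add_increasing2 intro: order_trans[of _ 0])
  also have "\<dots> = 2"
    by (subst Bochner_Integration.integral_add) auto
  finally show ?thesis .
qed

text \<open>The Hellinger affinity of the two densities is \<open>exp (- \<parallel>m - m'\<parallel>\<^sup>2 / 8)\<close>; the bound follows from
  \<open>p - q = (\<surd>p - \<surd>q) (\<surd>p + \<surd>q)\<close> and the weighted AM-GM inequality.\<close>

lemma integral_normal_Rn_diff_le: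
  "(\<integral>x. \<bar>normal_Rn d m x - normal_Rn d m' x\<bar> \<partial>lebesgue_Rn d) \<le> L2_set (\<lambda>j. m j - m' j) {..<d}"
proof (cases "L2_set (\<lambda>j. m j - m' j) {..<d} = 0")
  case True
  then have "normal_Rn d m = normal_Rn d m'"
    by (auto simp: normal_Rn_def fun_eq_iff L2_set_eq_0_iff intro!: prod.cong)
  then show ?thesis using True by simp
next
  case False
  define D where "D = L2_set (\<lambda>j. m j - m' j) {..<d}"
  have D: "D > 0" using False unfolding D_def by (metis L2_set_nonneg less_eq_real_def)
  define r where "r = exp (- (D\<^sup>2) / 8)"
  \<comment> \<open>Once \<open>1 - r\<close> is bounded by \<open>D\<^sup>2 / 8\<close> and
    \<open>1 + r\<close> by 2, the estimate reads \<open>D\<^sup>2 / (8 * t) + 2 * t\<close>. This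
    is smallest at \<open>t = D / 4\<close>, where it equals \<open>D\<close>.\<close>
  define t where "t = D / 4"
  have t: "t > 0" using D by (simp add: t_def)
  let ?c = "normal_Rn d (\<lambda>j. (m j + m' j) / 2)"
  \<comment> \<open>With \<open>p\<close> and \<open>q\<close> the square roots of the two
    densities, this is \<open>(p - q)\<^sup>2 / (2 * t) + t * (p + q)\<^sup>2 / 2\<close> expanded;
    the cross term \<open>p * q\<close> is the midpoint density \<open>?c\<close> scaled by
    \<open>r\<close>.\<close>
  let ?h = "\<lambda>x. (1 / (2 * t) + t / 2) * normal_Rn d m x + (1 / (2 * t) + t / 2) * normal_Rn d m' x
      + (t - 1 / t) * (r * ?c x)"
  have le: "\<bar>normal_Rn d m x - normal_Rn d m' x\<bar> \<le> ?h x" for x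
  proof -
    define p q where "p = sqrt (normal_Rn d m x)" and "q = sqrt (normal_Rn d m' x)"
    have pq: "normal_Rn d m x = p\<^sup>2" "normal_Rn d m' x = q\<^sup>2" "p \<ge> 0" "q \<ge> 0"
      by (auto simp: p_def q_def)
    have "r * ?c x = p * q"
      using sqrt_normal_Rn_mult[of d m x m']
      by (simp add: p_def q_def r_def D_def L2_set_def sum_nonneg real_sqrt_mult)
    then have h: "?h x = (1 / (2 * t) + t / 2) * p\<^sup>2 + (1 / (2 * t) + t / 2) * q\<^sup>2
        + (t - 1 / t) * (p * q)"
      unfolding pq by simp
    have "a * b \<le> a\<^sup>2 / (2 * t) + t * b\<^sup>2 / 2" for a b :: real
    proof -
      have "0 \<le> (a - t * b)\<^sup>2 / (2 * t)" using t by simp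
      also have "\<dots> = a\<^sup>2 / (2 * t) + t * b\<^sup>2 / 2 - a * b"
        using t by (simp add: power2_eq_square field_simps)
      finally show ?thesis by simp
    qed
    from this[of "\<bar>p - q\<bar>" "p + q"]
    have "\<bar>p - q\<bar> * (p + q) \<le> (p - q)\<^sup>2 / (2 * t) + t * (p + q)\<^sup>2 / 2" by simp
    also have "\<dots> = ?h x"
      unfolding h using t by (simp add: power2_eq_square field_simps)
    finally have "\<bar>p - q\<bar> * (p + q) \<le> ?h x" .
    moreover have "\<bar>p\<^sup>2 - q\<^sup>2\<bar> = \<bar>p - q\<bar> * (p + q)"
      using pq by (simp add: power2_eq_square square_diff_square_factored abs_mult mult.commute)
    ultimately show ?thesis using pq by simp
  qed
  have "(\<integral>x. \<bar>normal_Rn d m x - normal_Rn d m' x\<bar> \<partial>lebesgue_Rn d) \<le> (\<integral>x. ?h x \<partial>lebesgue_Rn d)"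
    by (intro integral_mono le integrable_abs Bochner_Integration.integrable_diff
          Bochner_Integration.integrable_add integrable_mult_right integrable_normal_Rn)
  also have "\<dots> = (1 - r) / t + t * (1 + r)"
    using t by (simp add: field_simps)
  also have "\<dots> \<le> (D\<^sup>2 / 8) / t + t * 2"
  proof (intro add_mono divide_right_mono mult_left_mono)
    show "1 - r \<le> D\<^sup>2 / 8" unfolding r_def using exp_ge_add_one_self[of "- (D\<^sup>2) / 8"] by linarith
    show "1 + r \<le> 2" by (simp add: r_def)
  qed (use t in auto)
  also have "\<dots> = D" using D by (simp add: t_def power2_eq_square)
  finally show ?thesis by (simp add: D_def)
qed

section \<open>Integration under the joint law of observation and label\<close>

lemma sets_joint_law [measurable_cong, simp]:
  "sets (joint_law d K pY p) = sets (lebesgue_Rn d \<Otimes>\<^sub>M count_space {1..K})"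
  by (simp add: joint_law_def)

lemma measurable_coordinate:
  assumes "j < d"
  shows "(\<lambda>(x, y). x j) \<in> borel_measurable (lebesgue_Rn d \<Otimes>\<^sub>M count_space {1..K})"
proof -
  have "(\<lambda>x. x j) \<in> borel_measurable (lebesgue_Rn d)"
    using assms by (simp add: lebesgue_Rn_def)
  then show ?thesis by measurable
qed

lemma measurable_label:
  fixes f :: "nat \<Rightarrow> real"
  shows "(\<lambda>(x, y). f y) \<in> borel_measurable (lebesgue_Rn d \<Otimes>\<^sub>M count_space {1..K})"
  using measurable_compose[OF measurable_snd, of f "count_space {1..K}" borel "lebesgue_Rn d"]
  by (simp add: case_prod_unfold)

lemma measurable_normal_Rn_label:
  fixes \<mu> :: "nat \<Rightarrow> nat \<Rightarrow> real"
  shows "(\<lambda>(x, y). normal_Rn d (\<mu> y) x) \<in> borel_measurable (lebesgue_Rn d \<Otimes>\<^sub>M count_space {1..K})"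
proof -
  have 1: "(\<lambda>z. fst z j) \<in> borel_measurable (lebesgue_Rn d \<Otimes>\<^sub>M count_space {1..K})" if "j < d" for j
    using measurable_coordinate[OF that] by (simp add: case_prod_unfold)
  have 2: "(\<lambda>z. \<mu> (snd z) j) \<in> borel_measurable (lebesgue_Rn d \<Otimes>\<^sub>M count_space {1..K})" for j
    using measurable_label[of "\<lambda>y. \<mu> y j"] by (simp add: case_prod_unfold)
  have "(\<lambda>z. \<Sum>j<d. (fst z j - \<mu> (snd z) j)\<^sup>2)
      \<in> borel_measurable (lebesgue_Rn d \<Otimes>\<^sub>M count_space {1..K})"
    using 1 2 by (intro borel_measurable_sum borel_measurable_power borel_measurable_diff) auto
  then show ?thesis
    unfolding normal_Rn_eq case_prod_unfold by measurable
qed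

text \<open>Tonelli's theorem, integrating out \<open>x\<close> first, turns every expectation into
  a finite mixture over the labels, so exponential moments can be computed label by label.\<close>

lemma nn_integral_joint_normal:
  assumes f: "f \<in> borel_measurable (lebesgue_Rn d \<Otimes>\<^sub>M count_space {1..K})"
  shows "(\<integral>\<^sup>+z. f z \<partial>joint_law d K pY (\<lambda>x k. normal_Rn d (\<mu> k) x)) =
    (\<Sum>k\<in>{1..K}. ennreal (pmf pY k) * (\<integral>\<^sup>+x. ennreal (normal_Rn d (\<mu> k) x) * f (x, k) \<partial>lebesgue_Rn d))"
proof -
  interpret R: sigma_finite_measure "lebesgue_Rn d" by (rule sigma_finite_lebesgue_Rn)
  interpret N: sigma_finite_measure "count_space {1..K}"
    by (rule sigma_finite_measure_count_space_finite) simp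
  interpret P: pair_sigma_finite "lebesgue_Rn d" "count_space {1..K}" ..
  define w where "w = (\<lambda>z. ennreal (case z of (x, y) \<Rightarrow> normal_Rn d (\<mu> y) x * pmf pY y))"
  have "(\<lambda>z. (case z of (x, y) \<Rightarrow> normal_Rn d (\<mu> y) x) * (case z of (x, y) \<Rightarrow> pmf pY y))
      \<in> borel_measurable (lebesgue_Rn d \<Otimes>\<^sub>M count_space {1..K})"
    by (intro borel_measurable_times measurable_normal_Rn_label measurable_label)
  also have "(\<lambda>z. (case z of (x, y) \<Rightarrow> normal_Rn d (\<mu> y) x) * (case z of (x, y) \<Rightarrow> pmf pY y)) =
      (\<lambda>z. case z of (x, y) \<Rightarrow> normal_Rn d (\<mu> y) x * pmf pY y)"
    by (rule ext) (simp split: prod.split)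
  finally have w: "w \<in> borel_measurable (lebesgue_Rn d \<Otimes>\<^sub>M count_space {1..K})"
    unfolding w_def by (rule measurable_compose[OF _ measurable_ennreal])
  have law: "joint_law d K pY (\<lambda>x k. normal_Rn d (\<mu> k) x) =
      density (lebesgue_Rn d \<Otimes>\<^sub>M count_space {1..K}) w"
    unfolding joint_law_def w_def by (rule arg_cong[of _ _ "density _"]) (simp add: fun_eq_iff)
  have "(\<integral>\<^sup>+z. f z \<partial>joint_law d K pY (\<lambda>x k. normal_Rn d (\<mu> k) x)) =
      (\<integral>\<^sup>+z. w z * f z \<partial>(lebesgue_Rn d \<Otimes>\<^sub>M count_space {1..K}))"
    unfolding law by (rule nn_integral_density[OF w f])
  also have "\<dots> = (\<integral>\<^sup>+k. \<integral>\<^sup>+x. w (x, k) * f (x, k) \<partial>lebesgue_Rn d \<partial>count_space {1..K})"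
    by (rule P.nn_integral_snd[symmetric]) (intro borel_measurable_times_ennreal w f)
  also have "\<dots> = (\<Sum>k\<in>{1..K}. \<integral>\<^sup>+x. w (x, k) * f (x, k) \<partial>lebesgue_Rn d)"
    by (rule nn_integral_count_space_finite) simp
  also have "\<dots> = (\<Sum>k\<in>{1..K}. ennreal (pmf pY k) *
      (\<integral>\<^sup>+x. ennreal (normal_Rn d (\<mu> k) x) * f (x, k) \<partial>lebesgue_Rn d))"
  proof (intro sum.cong refl)
    fix k assume k: "k \<in> {1..K}"
    have fk: "(\<lambda>x. f (x, k)) \<in> borel_measurable (lebesgue_Rn d)"
      by (rule measurable_compose[OF measurable_Pair2' f]) (use k in simp)
    have "(\<integral>\<^sup>+x. w (x, k) * f (x, k) \<partial>lebesgue_Rn d) =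
        (\<integral>\<^sup>+x. ennreal (pmf pY k) * (ennreal (normal_Rn d (\<mu> k) x) * f (x, k)) \<partial>lebesgue_Rn d)"
      by (simp add: w_def ennreal_mult mult_ac)
    also have "\<dots> = ennreal (pmf pY k) *
        (\<integral>\<^sup>+x. ennreal (normal_Rn d (\<mu> k) x) * f (x, k) \<partial>lebesgue_Rn d)"
      by (rule nn_integral_cmult)
        (intro borel_measurable_times_ennreal fk measurable_compose[OF measurable_normal_Rn measurable_ennreal])
    finally show "(\<integral>\<^sup>+x. w (x, k) * f (x, k) \<partial>lebesgue_Rn d) =
        ennreal (pmf pY k) * (\<integral>\<^sup>+x. ennreal (normal_Rn d (\<mu> k) x) * f (x, k) \<partial>lebesgue_Rn d)" .
  qed
  finally show ?thesis .
qed

section \<open>Exponential tail bounds for the sample\<close>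

text \<open>Independence factors the exponential moment of the sum into \<open>n\<close> factors,
  each at most 1; Markov's inequality for the exponential of the sum then gives the tail.\<close>

lemma prob_sum_score_ge:
  fixes g :: "'a \<Rightarrow> real" and n :: nat
  assumes M: "prob_space M" and g: "g \<in> borel_measurable M" and 1: "(\<integral>\<^sup>+z. ennreal (exp (g z)) \<partial>M) \<le> 1"
  shows "{S \<in> space (PiM {..<n} (\<lambda>_. M)). L \<le> (\<Sum>i<n. g (S i))} \<in> sets (PiM {..<n} (\<lambda>_. M))"
    and "measure (PiM {..<n} (\<lambda>_. M)) {S \<in> space (PiM {..<n} (\<lambda>_. M)). L \<le> (\<Sum>i<n. g (S i))} \<le> exp (- L)"
proof -
  interpret M: prob_space M by (rule M)
  interpret P: product_prob_space "\<lambda>_::nat. M" by standard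
  let ?P = "PiM {..<n} (\<lambda>_. M)"
  interpret PP: prob_space ?P by (rule prob_space_PiM) (rule M)
  have gi: "(\<lambda>S. g (S i)) \<in> borel_measurable ?P" if "i < n" for i
    by (rule measurable_compose[OF _ g], rule measurable_component_singleton) (use that in simp)
  have sum: "(\<lambda>S. \<Sum>i<n. g (S i)) \<in> borel_measurable ?P"
    using gi by (intro borel_measurable_sum) auto
  then show "{S \<in> space ?P. L \<le> (\<Sum>i<n. g (S i))} \<in> sets ?P"
    by measurable
  let ?u = "\<lambda>S. ennreal (exp (\<Sum>i<n. g (S i)))"
  have uM: "?u \<in> borel_measurable ?P"
    by (intro measurable_compose[OF _ measurable_ennreal] measurable_compose[OF sum] borel_measurable_exp)
  have "(\<integral>\<^sup>+S. ?u S \<partial>?P) = (\<integral>\<^sup>+S. (\<Prod>i<n. ennreal (exp (g (S i)))) \<partial>?P)"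
    by (simp add: exp_sum prod_ennreal)
  also have "\<dots> = (\<Prod>i<n. \<integral>\<^sup>+z. ennreal (exp (g z)) \<partial>M)"
    using g by (intro P.product_nn_integral_prod) auto
  also have "\<dots> \<le> 1"
    using 1 by (simp add: power_le_one)
  finally have u: "(\<integral>\<^sup>+S. ?u S \<partial>?P) \<le> 1" .
  have "emeasure ?P {S \<in> space ?P. L \<le> (\<Sum>i<n. g (S i))}
      = emeasure ?P {S \<in> space ?P. 1 \<le> ennreal (exp (- L)) * ?u S}"
    by (simp only: ennreal_mult[symmetric] exp_ge_zero mult_exp_exp ennreal_ge_1 one_le_exp_iff
        le_diff_eq add_0_left add.commute[of "- L"] diff_conv_add_uminus[symmetric])
  also have "\<dots> \<le> ennreal (exp (- L)) * (\<integral>\<^sup>+S. ?u S * indicator (space ?P) S \<partial>?P)"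
    using uM by (intro nn_integral_Markov_inequality borel_measurable_times_ennreal) auto
  also have "(\<integral>\<^sup>+S. ?u S * indicator (space ?P) S \<partial>?P) = (\<integral>\<^sup>+S. ?u S \<partial>?P)"
    by (intro nn_integral_cong) simp
  also have "ennreal (exp (- L)) * \<dots> \<le> ennreal (exp (- L)) * 1"
    by (intro mult_left_mono u) simp
  finally show "measure ?P {S \<in> space ?P. L \<le> (\<Sum>i<n. g (S i))} \<le> exp (- L)"
    by (simp add: PP.emeasure_eq_measure)
qed

lemma prob_all_scores_less:
  fixes F :: "('a \<Rightarrow> real) set" and n :: nat and L :: real
  assumes M: "prob_space M" and F: "finite F"
    and g: "\<And>g. g \<in> F \<Longrightarrow> g \<in> borel_measurable M"
    and 1: "\<And>g. g \<in> F \<Longrightarrow> (\<integral>\<^sup>+z. ennreal (exp (g z)) \<partial>M) \<le> 1"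
  defines "E \<equiv> {S \<in> space (PiM {..<n} (\<lambda>_. M)). \<forall>g\<in>F. (\<Sum>i<n. g (S i)) < L}"
  shows "E \<in> sets (PiM {..<n} (\<lambda>_. M))"
    and "1 - real (card F) * exp (- L) \<le> measure (PiM {..<n} (\<lambda>_. M)) E"
proof -
  let ?P = "PiM {..<n} (\<lambda>_. M)"
  interpret PP: prob_space ?P by (rule prob_space_PiM) (rule M)
  define A where "A g = {S \<in> space ?P. L \<le> (\<Sum>i<n. g (S i))}" for g :: "'a \<Rightarrow> real"
  have A: "A g \<in> sets ?P" "measure ?P (A g) \<le> exp (- L)" if "g \<in> F" for g
    unfolding A_def using prob_sum_score_ge[OF M g[OF that] 1[OF that], of n L] by auto
  have E: "E = space ?P - (\<Union>g\<in>F. A g)"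
    by (auto simp: E_def A_def not_le)
  have U: "(\<Union>g\<in>F. A g) \<in> sets ?P"
    using A F by auto
  then show "E \<in> sets ?P" unfolding E by simp
  have "measure ?P (\<Union>g\<in>F. A g) \<le> (\<Sum>g\<in>F. measure ?P (A g))"
    using A F by (intro PP.finite_measure_subadditive_finite) auto
  also have "\<dots> \<le> (\<Sum>g\<in>F. exp (- L))"
    using A by (intro sum_mono)
  also have "\<dots> = real (card F) * exp (- L)" by simp
  finally show "1 - real (card F) * exp (- L) \<le> measure ?P E"
    unfolding E using PP.prob_compl[OF U] by simp
qed

lemma prob_space_joint_normal:
  fixes \<mu> :: "nat \<Rightarrow> nat \<Rightarrow> real"
  assumes "set_pmf pY \<subseteq> {1..K}"
  shows "prob_space (joint_law d K pY (\<lambda>x k. normal_Rn d (\<mu> k) x))" (is "prob_space ?M")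
proof
  have "emeasure ?M (space ?M) = (\<integral>\<^sup>+z. 1 \<partial>?M)" by simp
  also have "\<dots> = (\<Sum>k\<in>{1..K}. ennreal (pmf pY k))"
    by (subst nn_integral_joint_normal) auto
  also have "\<dots> = 1"
    using assms by (simp add: sum_ennreal sum_pmf_eq_1)
  finally show "emeasure ?M (space ?M) = 1" .
qed

section \<open>Scores of one observation and their exponential moments\<close>

text \<open>Guards against undercounting: a sum below \<open>L\<close> means that label
  \<open>k\<close> occurs more than \<open>n * pmf pY k / 2 - L\<close> times. Halving the expected
  frequency leaves the room that makes the exponential moment at most 1.\<close>

definition count_score :: "nat pmf \<Rightarrow> nat \<Rightarrow> (nat \<Rightarrow> real) \<times> nat \<Rightarrow> real" where
  "count_score pY k = (\<lambda>(x, y). pmf pY k / 2 - of_bool (y = k))"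

text \<open>On labels in \<open>G\<close> this is the log-likelihood ratio for moving coordinate
  \<open>j\<close> of the mean by \<open>t\<close>. It vanishes on all other labels, so its sum sees
  only the observations of the group.\<close>

definition noise_score ::
  "(nat \<Rightarrow> nat \<Rightarrow> real) \<Rightarrow> nat set \<Rightarrow> nat \<Rightarrow> real \<Rightarrow> (nat \<Rightarrow> real) \<times> nat \<Rightarrow> real" where
  "noise_score \<mu> G j t = (\<lambda>(x, y). of_bool (y \<in> G) * (t * (x j - \<mu> y j) - t\<^sup>2 / 2))"

lemma measurable_count_score:
  "count_score pY k \<in> borel_measurable (joint_law d K pY p)"
  unfolding count_score_def measurable_cong_sets[OF sets_joint_law refl] by (rule measurable_label)

lemma measurable_noise_score:
  assumes "j < d"
  shows "noise_score \<mu> G j t \<in> borel_measurable (joint_law d K pY p)"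
proof -
  have 1: "(\<lambda>z. fst z j) \<in> borel_measurable (lebesgue_Rn d \<Otimes>\<^sub>M count_space {1..K})"
    using measurable_coordinate[OF assms] by (simp add: case_prod_unfold)
  have 2: "(\<lambda>z. f (snd z)) \<in> borel_measurable (lebesgue_Rn d \<Otimes>\<^sub>M count_space {1..K})"
    for f :: "nat \<Rightarrow> real"
    using measurable_label[of f] by (simp add: case_prod_unfold)
  have "(\<lambda>z. of_bool (snd z \<in> G) * (t * (fst z j - \<mu> (snd z) j) - t\<^sup>2 / 2))
      \<in> borel_measurable (lebesgue_Rn d \<Otimes>\<^sub>M count_space {1..K})"
    by (intro borel_measurable_times borel_measurable_diff borel_measurable_const 1
        2[of "\<lambda>y. of_bool (y \<in> G)"] 2[of "\<lambda>y. \<mu> y j"])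
  then show ?thesis
    by (simp add: noise_score_def case_prod_unfold cong: measurable_cong_sets)
qed

text \<open>With \<open>q = pmf pY k\<close> the moment equals
  \<open>exp (q / 2) * (1 - q * (1 - exp (- 1)))\<close>. Since \<open>exp 1\<close> is at least 2,
  the second factor is at most \<open>1 - q / 2\<close>, hence at most
  \<open>exp (- (q / 2))\<close>.\<close>

lemma nn_integral_exp_count_score:
  fixes \<mu> :: "nat \<Rightarrow> nat \<Rightarrow> real"
  assumes pY: "set_pmf pY \<subseteq> {1..K}" and k: "k \<in> {1..K}"
  shows "(\<integral>\<^sup>+z. ennreal (exp (count_score pY k z)) \<partial>joint_law d K pY (\<lambda>x k. normal_Rn d (\<mu> k) x)) \<le> 1"
    (is "?I \<le> 1")
proof -
  define q where "q = pmf pY k"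
  have q: "0 \<le> q" "q \<le> 1" by (auto simp: q_def pmf_le_1)
  define w where "w l = exp (q / 2 - of_bool (l = k))" for l :: nat
  have meas: "(\<lambda>z. ennreal (exp (count_score pY k z)))
      \<in> borel_measurable (lebesgue_Rn d \<Otimes>\<^sub>M count_space {1..K})"
    using measurable_count_score[of pY k d K undefined] by (simp cong: measurable_cong_sets)
  have "?I = (\<Sum>l\<in>{1..K}. ennreal (pmf pY l) *
      (\<integral>\<^sup>+x. ennreal (normal_Rn d (\<mu> l) x) * ennreal (w l) \<partial>lebesgue_Rn d))"
    by (subst nn_integral_joint_normal[OF meas]) (simp add: count_score_def w_def q_def)
  also have "\<dots> = (\<Sum>l\<in>{1..K}. ennreal (pmf pY l * w l))"
    by (simp add: nn_integral_multc ennreal_mult w_def)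
  also have "\<dots> = ennreal (\<Sum>l\<in>{1..K}. pmf pY l * w l)"
    by (simp add: sum_ennreal w_def)
  finally have I: "?I = ennreal (\<Sum>l\<in>{1..K}. pmf pY l * w l)" .
  have "(\<Sum>l\<in>{1..K}. pmf pY l * w l)
      = (\<Sum>l\<in>{1..K}. pmf pY l * exp (q / 2) + (if l = k then q * (exp (q / 2 - 1) - exp (q / 2)) else 0))"
    by (intro sum.cong refl) (auto simp: w_def q_def algebra_simps)
  also have "\<dots> = exp (q / 2) + q * (exp (q / 2 - 1) - exp (q / 2))"
    using k pY by (simp add: sum.distrib sum_distrib_right[symmetric] sum_pmf_eq_1)
  also have "\<dots> = exp (q / 2) * (1 - q * (1 - exp (- 1)))"
    using exp_add[of "q / 2" "- 1"] by (simp add: algebra_simps)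
  also have "\<dots> \<le> exp (q / 2) * exp (- (q / 2))"
  proof (intro mult_left_mono)
    have "exp (- 1) \<le> (1 / 2 :: real)"
      using exp_ge_add_one_self[of 1] by (simp add: exp_minus field_simps)
    then have "q * (1 / 2) \<le> q * (1 - exp (- 1))" by (intro mult_left_mono q) simp
    moreover have "1 - q / 2 \<le> exp (- (q / 2))" using exp_ge_add_one_self[of "- (q / 2)"] by simp
    ultimately show "1 - q * (1 - exp (- 1)) \<le> exp (- (q / 2))" by linarith
  qed simp
  also have "\<dots> = 1" by (simp add: mult_exp_exp)
  finally show ?thesis unfolding I by (simp add: ennreal_le_1)
qed

text \<open>Given the label, the weight either shifts the Gaussian density or leaves it alone, so
  each conditional integral is exactly 1.\<close>

lemma nn_integral_exp_noise_score:
  fixes \<mu> :: "nat \<Rightarrow> nat \<Rightarrow> real"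
  assumes pY: "set_pmf pY \<subseteq> {1..K}" and j: "j < d"
  shows "(\<integral>\<^sup>+z. ennreal (exp (noise_score \<mu> G j t z)) \<partial>joint_law d K pY (\<lambda>x k. normal_Rn d (\<mu> k) x)) \<le> 1"
    (is "?I \<le> 1")
proof -
  have meas: "(\<lambda>z. ennreal (exp (noise_score \<mu> G j t z)))
      \<in> borel_measurable (lebesgue_Rn d \<Otimes>\<^sub>M count_space {1..K})"
    using measurable_noise_score[OF j, of \<mu> G t K pY undefined] by (simp cong: measurable_cong_sets)
  have "?I = (\<Sum>k\<in>{1..K}. ennreal (pmf pY k) *
      (\<integral>\<^sup>+x. ennreal (normal_Rn d (\<mu> k) x) * ennreal (exp (noise_score \<mu> G j t (x, k))) \<partial>lebesgue_Rn d))"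
    by (rule nn_integral_joint_normal[OF meas])
  also have "\<dots> = (\<Sum>k\<in>{1..K}. ennreal (pmf pY k))"
  proof (intro sum.cong refl)
    fix k
    define m where "m = (if k \<in> G then (\<mu> k)(j := \<mu> k j + t) else \<mu> k)"
    have "ennreal (normal_Rn d (\<mu> k) x) * ennreal (exp (noise_score \<mu> G j t (x, k))) =
        ennreal (normal_Rn d m x)" for x
      using normal_Rn_tilt[OF j, of "\<mu> k" x t]
      by (auto simp: noise_score_def m_def ennreal_mult[symmetric])
    then show "ennreal (pmf pY k) * (\<integral>\<^sup>+x. ennreal (normal_Rn d (\<mu> k) x) *
        ennreal (exp (noise_score \<mu> G j t (x, k))) \<partial>lebesgue_Rn d) = ennreal (pmf pY k)"
      by simp
  qed
  also have "\<dots> = 1" using pY by (simp add: sum_ennreal sum_pmf_eq_1)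
  finally show ?thesis by simp
qed

section \<open>Deviation of a least squares solution\<close>

text \<open>AM-GM, weighted so that only half of \<open>m * a\<^sup>2\<close> is spent and can later
  be absorbed. For \<open>m = 0\<close> the assumption forces \<open>s = 0\<close>.\<close>

lemma two_mult_le_quadratic:
  fixes a s m L :: real
  assumes "s\<^sup>2 \<le> 2 * L * m" "0 \<le> m" "0 \<le> L"
  shows "2 * a * s \<le> m * a\<^sup>2 / 2 + 4 * L"
proof (cases "m = 0")
  case True
  then show ?thesis using assms by simp
next
  case False
  then have m: "m > 0" using assms by simp
  have "0 \<le> (m * a - 2 * s)\<^sup>2" by simp
  also have "\<dots> = m * (m * a\<^sup>2 - 4 * a * s) + 4 * s\<^sup>2"
    by (simp add: power2_eq_square algebra_simps)
  also have "\<dots> \<le> m * (m * a\<^sup>2 - 4 * a * s) + 4 * (2 * L * m)"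
    using assms by simp
  also have "\<dots> = m * (2 * (m * a\<^sup>2 / 2 + 4 * L - 2 * a * s))"
    by (simp add: power2_eq_square algebra_simps)
  finally show ?thesis using m by (simp add: zero_le_mult_iff)
qed

lemma sum_by_label:
  fixes f :: "nat \<Rightarrow> real"
  assumes "\<And>i. i < n \<Longrightarrow> y i \<in> {1..K::nat}"
  shows "(\<Sum>i<n. f i) = (\<Sum>k\<in>{1..K}. \<Sum>i | i < n \<and> y i = k. f i)"
proof -
  have "(\<Sum>k\<in>{1..K}. \<Sum>i\<in>{i \<in> {..<n}. y i = k}. f i) = sum f {..<n}"
    using assms by (intro sum.group) auto
  then show ?thesis by simp
qed

text \<open>A label-specific coordinate costs \<open>4 * L\<close> once per label, a shared one only
  once, in total \<open>4 * L * (K * d1 + d - d1)\<close>. The quadratic parts add up to half of the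
  left-hand side; absorbing that half doubles the constant to 8.\<close>

lemma least_squares_deviation:
  fixes x \<mu> \<nu> :: "nat \<Rightarrow> nat \<Rightarrow> real" and y :: "nat \<Rightarrow> nat"
  assumes y: "\<And>i. i < n \<Longrightarrow> y i \<in> {1..K}" and K: "1 \<le> K" and d1: "d1 \<le> d" and L: "0 \<le> L"
    and le: "(\<Sum>i<n. \<Sum>j<d. (x i j - \<nu> (y i) j)\<^sup>2) \<le> (\<Sum>i<n. \<Sum>j<d. (x i j - \<mu> (y i) j)\<^sup>2)"
    and common: "\<And>k j. k \<in> {1..K} \<Longrightarrow> d1 \<le> j \<Longrightarrow> \<nu> k j - \<mu> k j = \<nu> 1 j - \<mu> 1 j"
    and noise: "\<And>G j. G \<in> insert {1..K} ((\<lambda>k. {k}) ` {1..K}) \<Longrightarrow> j < d \<Longrightarrow>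
      (\<Sum>i | i < n \<and> y i \<in> G. x i j - \<mu> (y i) j)\<^sup>2 \<le> 2 * L * real (card {i. i < n \<and> y i \<in> G})"
  shows "(\<Sum>k\<in>{1..K}. real (card {i. i < n \<and> y i = k}) * (\<Sum>j<d. (\<nu> k j - \<mu> k j)\<^sup>2))
    \<le> 8 * L * ((real K - 1) * real d1 + real d)"
proof -
  define a where "a k j = \<nu> k j - \<mu> k j" for k j
  define z where "z i j = x i j - \<mu> (y i) j" for i j
  have group: "2 * a k j * (\<Sum>i | i < n \<and> y i \<in> G. z i j)
      \<le> real (card {i. i < n \<and> y i \<in> G}) * (a k j)\<^sup>2 / 2 + 4 * L"
    if "G \<in> insert {1..K} ((\<lambda>k. {k}) ` {1..K})" "j < d" for G j k
    using noise[OF that] L unfolding z_def by (intro two_mult_le_quadratic) auto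
  have coord: "(\<Sum>i<n. 2 * a (y i) j * z i j)
      \<le> (\<Sum>i<n. (a (y i) j)\<^sup>2) / 2 + 4 * L * (if j < d1 then real K else 1)" if j: "j < d" for j
  proof (cases "j < d1")
    case True
    have "(\<Sum>i<n. 2 * a (y i) j * z i j) = (\<Sum>k\<in>{1..K}. \<Sum>i | i < n \<and> y i = k. 2 * a (y i) j * z i j)"
      by (rule sum_by_label[OF y])
    also have "\<dots> = (\<Sum>k\<in>{1..K}. 2 * a k j * (\<Sum>i | i < n \<and> y i \<in> {k}. z i j))"
      by (intro sum.cong refl) (simp add: sum_distrib_left)
    also have "\<dots> \<le> (\<Sum>k\<in>{1..K}. real (card {i. i < n \<and> y i \<in> {k}}) * (a k j)\<^sup>2 / 2 + 4 * L)"
      by (intro sum_mono group j) auto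
    also have "\<dots> = (\<Sum>k\<in>{1..K}. \<Sum>i | i < n \<and> y i = k. (a (y i) j)\<^sup>2) / 2 + 4 * L * real K"
      by (simp add: sum.distrib sum_divide_distrib)
    also have "(\<Sum>k\<in>{1..K}. \<Sum>i | i < n \<and> y i = k. (a (y i) j)\<^sup>2) = (\<Sum>i<n. (a (y i) j)\<^sup>2)"
      by (rule sum_by_label[OF y, symmetric])
    finally show ?thesis using True by simp
  next
    case False
    \<comment> \<open>A shared coordinate deviates equally for all labels, with label 1 as
      representative. The deviation therefore factors out and the noise is summed over the whole
      sample.\<close>
    have a: "a (y i) j = a 1 j" if "i < n" for i
      using common[OF y[OF that], of j] False by (simp add: a_def)
    have all: "{i. i < n \<and> y i \<in> {1..K}} = {..<n}"
      using y by auto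
    have "(\<Sum>i<n. 2 * a (y i) j * z i j) = 2 * a 1 j * (\<Sum>i<n. z i j)"
      by (simp add: a sum_distrib_left)
    also have "\<dots> \<le> real n * (a 1 j)\<^sup>2 / 2 + 4 * L"
      using group[of "{1..K}" j 1] j unfolding all by simp
    also have "real n * (a 1 j)\<^sup>2 = (\<Sum>i<n. (a (y i) j)\<^sup>2)"
      by (simp add: a)
    finally show ?thesis using False by simp
  qed
  define T where "T = (\<Sum>j<d. \<Sum>i<n. (a (y i) j)\<^sup>2)"
  have "(\<Sum>i<n. \<Sum>j<d. (x i j - \<nu> (y i) j)\<^sup>2) =
      (\<Sum>i<n. \<Sum>j<d. (x i j - \<mu> (y i) j)\<^sup>2 + (a (y i) j)\<^sup>2 - 2 * a (y i) j * z i j)"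
    by (intro sum.cong refl) (simp add: a_def z_def power2_eq_square algebra_simps)
  also have "\<dots> = (\<Sum>i<n. \<Sum>j<d. (x i j - \<mu> (y i) j)\<^sup>2) + (\<Sum>i<n. \<Sum>j<d. (a (y i) j)\<^sup>2)
      - (\<Sum>i<n. \<Sum>j<d. 2 * a (y i) j * z i j)"
    by (simp add: sum.distrib sum_subtractf)
  finally have "(\<Sum>i<n. \<Sum>j<d. (a (y i) j)\<^sup>2) \<le> (\<Sum>i<n. \<Sum>j<d. 2 * a (y i) j * z i j)"
    using le by linarith
  then have "T \<le> (\<Sum>j<d. \<Sum>i<n. 2 * a (y i) j * z i j)"
    unfolding T_def by (simp only: sum.swap[of _ "{..<n}" "{..<d}"])
  also have "\<dots> \<le> (\<Sum>j<d. (\<Sum>i<n. (a (y i) j)\<^sup>2) / 2 + 4 * L * (if j < d1 then real K else 1))"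
    by (intro sum_mono coord) simp
  also have "\<dots> = T / 2 + 4 * L * (\<Sum>j<d. if j < d1 then real K else 1)"
    by (simp add: T_def sum.distrib sum_divide_distrib sum_distrib_left)
  also have "(\<Sum>j<d. if j < d1 then real K else 1) = (\<Sum>j<d. 1 + (if j \<in> {..<d1} then real K - 1 else 0))"
    by (intro sum.cong refl) simp
  also have "\<dots> = real d + real d1 * (real K - 1)"
    using d1 by (subst sum.distrib, subst sum.inter_restrict[symmetric]) (auto simp: Int_absorb1)
  finally have "T \<le> 8 * L * ((real K - 1) * real d1 + real d)"
    by (simp add: algebra_simps)
  also have "T = (\<Sum>i<n. \<Sum>j<d. (a (y i) j)\<^sup>2)"
    unfolding T_def by (rule sum.swap)
  also have "\<dots> = (\<Sum>k\<in>{1..K}. \<Sum>i | i < n \<and> y i = k. \<Sum>j<d. (a (y i) j)\<^sup>2)"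
    by (rule sum_by_label[OF y])
  also have "\<dots> = (\<Sum>k\<in>{1..K}. real (card {i. i < n \<and> y i = k}) * (\<Sum>j<d. (\<nu> k j - \<mu> k j)\<^sup>2))"
    by (intro sum.cong refl) (simp add: a_def)
  finally show ?thesis by simp
qed

section \<open>From deviations of the means to the averaged total variation\<close>

lemma avg_TV_error_normal_square_le:
  fixes \<mu> \<nu> :: "nat \<Rightarrow> nat \<Rightarrow> real"
  assumes pY: "set_pmf pY \<subseteq> {1..K}"
    and p: "\<And>k x. k \<in> {1..K} \<Longrightarrow> p x k = normal_Rn d (\<nu> k) x"
    and q: "\<And>k x. k \<in> {1..K} \<Longrightarrow> q x k = normal_Rn d (\<mu> k) x"
  shows "(avg_TV_error d pY p q)\<^sup>2 \<le> (\<Sum>k\<in>{1..K}. pmf pY k * min 1 ((\<Sum>j<d. (\<nu> k j - \<mu> k j)\<^sup>2) / 4))"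
proof -
  define a where "a k = 1/2 * (\<integral>x. \<bar>normal_Rn d (\<nu> k) x - normal_Rn d (\<mu> k) x\<bar> \<partial>lebesgue_Rn d)" for k
  define R where "R = (\<Sum>k\<in>{1..K}. pmf pY k * a k)"
  have avg: "avg_TV_error d pY p q = R"
    unfolding avg_TV_error_def using pY
    by (subst integral_measure_pmf_real[where A = "{1..K}"])
      (auto simp: R_def a_def p q mult.commute intro!: sum.cong)
  have a0: "0 \<le> a k" for k by (simp add: a_def)
  have a1: "(a k)\<^sup>2 \<le> 1" for k
    using integral_normal_Rn_diff_le_2[of d "\<nu> k" "\<mu> k"] a0[of k] by (intro power_le_one) (auto simp: a_def)
  have a2: "(a k)\<^sup>2 \<le> (\<Sum>j<d. (\<nu> k j - \<mu> k j)\<^sup>2) / 4" for k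
  proof -
    have "a k \<le> L2_set (\<lambda>j. \<nu> k j - \<mu> k j) {..<d} / 2"
      using integral_normal_Rn_diff_le[of d "\<nu> k" "\<mu> k"] by (simp add: a_def)
    then have "(a k)\<^sup>2 \<le> (L2_set (\<lambda>j. \<nu> k j - \<mu> k j) {..<d} / 2)\<^sup>2"
      by (intro power_mono a0)
    then show ?thesis by (simp add: L2_set_def sum_nonneg power_divide)
  qed
  have one: "(\<Sum>k\<in>{1..K}. pmf pY k) = 1" using pY by (simp add: sum_pmf_eq_1)
  \<comment> \<open>Nonnegativity of the variance of \<open>a\<close> under \<open>pY\<close>, which
    is Jensen's inequality for the square.\<close>
  have "0 \<le> (\<Sum>k\<in>{1..K}. pmf pY k * (a k - R)\<^sup>2)"
    by (intro sum_nonneg) simp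
  also have "\<dots> = (\<Sum>k\<in>{1..K}. pmf pY k * (a k)\<^sup>2) - 2 * R * (\<Sum>k\<in>{1..K}. pmf pY k * a k)
      + R\<^sup>2 * (\<Sum>k\<in>{1..K}. pmf pY k)"
    by (simp add: sum_distrib_left sum.distrib[symmetric] sum_subtractf[symmetric]
        power2_eq_square algebra_simps)
  also have "\<dots> = (\<Sum>k\<in>{1..K}. pmf pY k * (a k)\<^sup>2) - R\<^sup>2"
    unfolding one R_def[symmetric] by (simp add: power2_eq_square)
  finally have "R\<^sup>2 \<le> (\<Sum>k\<in>{1..K}. pmf pY k * (a k)\<^sup>2)" by simp
  also have "\<dots> \<le> (\<Sum>k\<in>{1..K}. pmf pY k * min 1 ((\<Sum>j<d. (\<nu> k j - \<mu> k j)\<^sup>2) / 4))"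
    by (intro sum_mono mult_left_mono min.boundedI a1 a2) simp
  finally show "(avg_TV_error d pY p q)\<^sup>2
      \<le> (\<Sum>k\<in>{1..K}. pmf pY k * min 1 ((\<Sum>j<d. (\<nu> k j - \<mu> k j)\<^sup>2) / 4))"
    by (simp add: avg)
qed

text \<open>Passing from counts to true frequencies costs \<open>2 * L\<close> per label. The total
  \<open>2 * L * K\<close> is absorbed because the parameter count is at least \<open>K\<close> as
  soon as \<open>d1\<close> is positive. For \<open>d1 = 0\<close> the count may be smaller than
  \<open>K\<close>, but then all \<open>W k\<close> agree and the weights simply sum to 1.\<close>

lemma weighted_truncated_sum_le:
  fixes W :: "nat \<Rightarrow> real" and c :: "nat \<Rightarrow> nat"
  assumes pY: "set_pmf pY \<subseteq> {1..K}" and n: "1 \<le> n" and L: "0 \<le> L" and d: "1 \<le> d" and K: "1 \<le> K"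
    and c: "(\<Sum>k\<in>{1..K}. c k) = n" and W0: "\<And>k. 0 \<le> W k"
    and counts: "\<And>k. k \<in> {1..K} \<Longrightarrow> real n * (pmf pY k / 2) - real (c k) \<le> L"
    and dev: "(\<Sum>k\<in>{1..K}. real (c k) * W k) \<le> 8 * L * ((real K - 1) * real d1 + real d)"
    and const: "\<And>k. d1 = 0 \<Longrightarrow> k \<in> {1..K} \<Longrightarrow> W k = W 1"
  shows "(\<Sum>k\<in>{1..K}. pmf pY k * min 1 (W k / 4)) \<le> 6 * L * (((real K - 1) * real d1 + real d) / real n)"
proof (cases "d1 = 0")
  case True
  have "real n * W 1 = (\<Sum>k\<in>{1..K}. real (c k) * W 1)"
    by (simp add: c[symmetric] sum_distrib_right)
  also have "\<dots> = (\<Sum>k\<in>{1..K}. real (c k) * W k)"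
    by (intro sum.cong refl) (metis True const)
  finally have nW: "real n * W 1 \<le> 8 * L * real d" using dev True by simp
  have "(\<Sum>k\<in>{1..K}. pmf pY k * min 1 (W k / 4)) \<le> (\<Sum>k\<in>{1..K}. pmf pY k * (W 1 / 4))"
  proof (intro sum_mono mult_left_mono)
    fix k assume "k \<in> {1..K}"
    from const[OF True this] show "min 1 (W k / 4) \<le> W 1 / 4" by simp
  qed simp
  also have "\<dots> = W 1 / 4"
    using pY by (simp add: sum_distrib_right[symmetric] sum_divide_distrib[symmetric] sum_pmf_eq_1)
  also have "\<dots> \<le> 2 * L * real d / real n"
    using nW n by (simp add: field_simps)
  also have "\<dots> \<le> 6 * L * real d / real n"
    using L by (intro divide_right_mono mult_right_mono) auto
  finally show ?thesis using True by simp
next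
  case False
  define D where "D = (real K - 1) * real d1 + real d"
  have "(real K - 1) * 1 \<le> (real K - 1) * real d1"
    using False K by (intro mult_left_mono) auto
  then have KD: "real K \<le> D" using d by (simp add: D_def)
  have "real n * (\<Sum>k\<in>{1..K}. pmf pY k * min 1 (W k / 4)) \<le>
      (\<Sum>k\<in>{1..K}. real (c k) * W k / 2 + 2 * L)"
    unfolding sum_distrib_left
  proof (intro sum_mono)
    fix k assume k: "k \<in> {1..K}"
    have m: "0 \<le> min 1 (W k / 4)" "min 1 (W k / 4) \<le> W k / 4" "min 1 (W k / 4) \<le> 1"
      using W0[of k] by auto
    have "real n * (pmf pY k * min 1 (W k / 4)) = (real n * pmf pY k) * min 1 (W k / 4)" by simp
    also have "\<dots> \<le> (2 * real (c k) + 2 * L) * min 1 (W k / 4)"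
      using counts[OF k] m by (intro mult_right_mono) auto
    also have "\<dots> = 2 * real (c k) * min 1 (W k / 4) + 2 * L * min 1 (W k / 4)"
      by (simp add: algebra_simps)
    \<comment> \<open>The minimum is bounded by \<open>W k / 4\<close> next to the count and by 1
      next to the error term, so the error is not multiplied by \<open>W k\<close>.\<close>
    also have "\<dots> \<le> 2 * real (c k) * (W k / 4) + 2 * L * 1"
      using L m by (intro add_mono mult_left_mono) auto
    finally show "real n * (pmf pY k * min 1 (W k / 4)) \<le> real (c k) * W k / 2 + 2 * L"
      by (simp add: mult.commute)
  qed
  also have "\<dots> = (\<Sum>k\<in>{1..K}. real (c k) * W k) / 2 + 2 * L * real K"
    by (simp add: sum.distrib sum_divide_distrib)
  \<comment> \<open>The first summand is half of the deviation bound \<open>8 * L * D\<close>;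
    together they give the constant 6.\<close>
  also have "\<dots> \<le> 4 * L * D + 2 * L * D"
    using dev L mult_left_mono[OF KD, of "2 * L"] unfolding D_def[symmetric] by linarith
  finally show ?thesis
    using n unfolding D_def[symmetric] by (simp add: field_simps)
qed

section \<open>The maximum likelihood estimator\<close>

lemma prod_power_of_bool:
  fixes f :: "nat \<Rightarrow> real"
  assumes "y \<in> {1..K}"
  shows "(\<Prod>k\<in>{1..K}. f k ^ of_bool (y = k)) = f y"
proof -
  have "(\<Prod>k\<in>{1..K}. f k ^ of_bool (y = k)) = (\<Prod>k\<in>{1..K}. if k = y then f k else 1)"
    by (intro prod.cong refl) auto
  then show ?thesis using assms by simp
qed

lemma likelihood_normal:
  assumes "\<And>i. i < n \<Longrightarrow> snd (S i) \<in> {1..K}"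
    and "\<And>k x. k \<in> {1..K} \<Longrightarrow> p x k = normal_Rn d (\<nu> k) x"
  shows "likelihood n S p =
    ((1 / sqrt (2 * pi)) ^ d) ^ n * exp (- (1/2) * (\<Sum>i<n. \<Sum>j<d. (fst (S i) j - \<nu> (snd (S i)) j)\<^sup>2))"
proof -
  have "likelihood n S p = (\<Prod>i<n. normal_Rn d (\<nu> (snd (S i))) (fst (S i)))"
    unfolding likelihood_def using assms by (intro prod.cong) auto
  also have "\<dots> = ((1 / sqrt (2 * pi)) ^ d) ^ n *
      (\<Prod>i<n. exp (- (1/2) * (\<Sum>j<d. (fst (S i) j - \<nu> (snd (S i)) j)\<^sup>2)))"
    unfolding normal_Rn_eq by (simp only: prod.distrib prod_constant card_lessThan)
  also have "(\<Prod>i<n. exp (- (1/2) * (\<Sum>j<d. (fst (S i) j - \<nu> (snd (S i)) j)\<^sup>2))) =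
      exp (- (1/2) * (\<Sum>i<n. \<Sum>j<d. (fst (S i) j - \<nu> (snd (S i)) j)\<^sup>2))"
    by (simp only: exp_sum[OF finite_lessThan] sum_distrib_left)
  finally show ?thesis .
qed

text \<open>The normalising factors agree and are positive, so comparing likelihoods compares
  residual sums in the reverse order.\<close>

lemma sum_squares_le_of_likelihood_le:
  assumes S: "\<And>i. i < n \<Longrightarrow> snd (S i) \<in> {1..K}"
    and p: "\<And>k x. k \<in> {1..K} \<Longrightarrow> p x k = normal_Rn d (\<nu> k) x"
    and q: "\<And>k x. k \<in> {1..K} \<Longrightarrow> q x k = normal_Rn d (\<mu> k) x"
    and le: "likelihood n S q \<le> likelihood n S p"
  shows "(\<Sum>i<n. \<Sum>j<d. (fst (S i) j - \<nu> (snd (S i)) j)\<^sup>2)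
    \<le> (\<Sum>i<n. \<Sum>j<d. (fst (S i) j - \<mu> (snd (S i)) j)\<^sup>2)"
proof -
  have lp: "likelihood n S p =
    ((1 / sqrt (2 * pi)) ^ d) ^ n * exp (- (1/2) * (\<Sum>i<n. \<Sum>j<d. (fst (S i) j - \<nu> (snd (S i)) j)\<^sup>2))"
    using S p by (rule likelihood_normal)
  have lq: "likelihood n S q =
    ((1 / sqrt (2 * pi)) ^ d) ^ n * exp (- (1/2) * (\<Sum>i<n. \<Sum>j<d. (fst (S i) j - \<mu> (snd (S i)) j)\<^sup>2))"
    using S q by (rule likelihood_normal)
  have "0 < ((1 / sqrt (2 * pi)) ^ d) ^ n" by simp
  then have "- (1/2) * (\<Sum>i<n. \<Sum>j<d. (fst (S i) j - \<mu> (snd (S i)) j)\<^sup>2)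
      \<le> - (1/2) * (\<Sum>i<n. \<Sum>j<d. (fst (S i) j - \<nu> (snd (S i)) j)\<^sup>2)"
    using le unfolding lp lq by (simp only: mult_le_cancel_left_pos exp_le_cancel_iff)
  then show ?thesis by linarith
qed

section \<open>Scores summed over a sample, and the size of the union bound\<close>

lemma sum_count_score:
  fixes n :: nat
  shows "(\<Sum>i<n. count_score pY k (S i)) = real n * (pmf pY k / 2) - real (card {i. i < n \<and> snd (S i) = k})"
proof -
  have "(\<Sum>i<n. of_bool (snd (S i) = k) :: real) = real (card {i. i < n \<and> snd (S i) = k})"
    by (simp add: of_bool_def sum.inter_filter[symmetric])
  then show ?thesis
    by (simp add: count_score_def case_prod_unfold sum_subtractf)
qed

lemma sum_noise_score:
  fixes n :: nat
  shows "(\<Sum>i<n. noise_score \<mu> G j t (S i)) =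
     t * (\<Sum>i | i < n \<and> snd (S i) \<in> G. fst (S i) j - \<mu> (snd (S i)) j)
       - real (card {i. i < n \<and> snd (S i) \<in> G}) * t\<^sup>2 / 2"
proof -
  have "(\<Sum>i<n. noise_score \<mu> G j t (S i)) =
      (\<Sum>i<n. if snd (S i) \<in> G then t * (fst (S i) j - \<mu> (snd (S i)) j) - t\<^sup>2 / 2 else 0)"
    by (intro sum.cong refl) (simp add: noise_score_def case_prod_unfold)
  also have "\<dots> = (\<Sum>i | i < n \<and> snd (S i) \<in> G. t * (fst (S i) j - \<mu> (snd (S i)) j) - t\<^sup>2 / 2)"
    by (subst sum.inter_filter[symmetric]) simp_all
  finally show ?thesis
    by (simp add: sum_subtractf sum_distrib_left right_diff_distrib)
qed

text \<open>Take the tilt \<open>t\<close> indexed by the realised group size \<open>m\<close>.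
  There \<open>m * t\<^sup>2 / 2 = L\<close>, so the two signs give
  \<open>abs (t * s) < 2 * L\<close>, and squaring yields the claim. An empty group has sum
  0.\<close>

lemma square_sum_noise_le:
  assumes L: "0 < L"
    and score: "\<And>m \<sigma>. m \<in> {1..n} \<Longrightarrow> \<sigma> \<in> {1, -1} \<Longrightarrow>
      (\<Sum>i<n. noise_score \<mu> G j (\<sigma> * sqrt (2 * L / real m)) (S i)) < L"
  shows "(\<Sum>i | i < n \<and> snd (S i) \<in> G. fst (S i) j - \<mu> (snd (S i)) j)\<^sup>2
    \<le> 2 * L * real (card {i. i < n \<and> snd (S i) \<in> G})"
proof -
  define s where "s = (\<Sum>i | i < n \<and> snd (S i) \<in> G. fst (S i) j - \<mu> (snd (S i)) j)"
  define m where "m = card {i. i < n \<and> snd (S i) \<in> G}"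
  show ?thesis
  proof (cases "m = 0")
    case True
    then have "{i. i < n \<and> snd (S i) \<in> G} = {}" by (simp add: m_def)
    then show ?thesis by (simp only: sum.empty card.empty) simp
  next
    case False
    have "m \<le> card {..<n}" unfolding m_def by (intro card_mono) auto
    then have m: "m \<in> {1..n}" using False by auto
    define t where "t = sqrt (2 * L / real m)"
    have t2: "real m * t\<^sup>2 = 2 * L" using m L by (simp add: t_def)
    have "t * s < 2 * L" "- t * s < 2 * L"
      using score[OF m, of 1] score[OF m, of "-1"] t2
      unfolding sum_noise_score s_def[symmetric] m_def[symmetric] t_def[symmetric] by auto
    then have "\<bar>t * s\<bar> \<le> 2 * L" by linarith
    then have "(t * s)\<^sup>2 \<le> (2 * L)\<^sup>2" using L by (intro power2_le_iff_abs_le[THEN iffD2]) auto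
    then have "real m * (t * s)\<^sup>2 \<le> real m * (2 * L)\<^sup>2" by (intro mult_left_mono) auto
    also have "real m * (t * s)\<^sup>2 = 2 * L * s\<^sup>2"
      using t2 by (simp add: power_mult_distrib)
    finally have "2 * L * s\<^sup>2 \<le> 2 * L * (2 * L * real m)"
      by (simp add: power2_eq_square algebra_simps)
    then have "s\<^sup>2 \<le> 2 * L * real m" using L by simp
    then show ?thesis by (simp add: s_def m_def)
  qed
qed

text \<open>The singletons control the noise in label-specific coordinates, the full label set the
  noise in shared ones.\<close>

definition label_groups :: "nat \<Rightarrow> nat set set" where
  "label_groups K = insert {1..K} ((\<lambda>k. {k}) ` {1..K})"

text \<open>The tilt \<open>\<plusminus>\<surd>(2L/m)\<close> is the optimal one when a group occurs \<open>m\<close> times in the sample. Taking a union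
  bound over all possible counts \<open>m\<close> avoids conditioning on the labels.\<close>

definition scores :: "nat \<Rightarrow> nat \<Rightarrow> nat \<Rightarrow> nat pmf \<Rightarrow> (nat \<Rightarrow> nat \<Rightarrow> real) \<Rightarrow> real
    \<Rightarrow> ((nat \<Rightarrow> real) \<times> nat \<Rightarrow> real) set" where
  "scores n d K pY \<mu> L = count_score pY ` {1..K} \<union>
     (\<lambda>(G, j, m, \<sigma>). noise_score \<mu> G j (\<sigma> * sqrt (2 * L / real m))) `
       (label_groups K \<times> {..<d} \<times> {1..n} \<times> {1, -1})"

lemma finite_scores: "finite (scores n d K pY \<mu> L)"
  by (simp add: scores_def label_groups_def)

lemma card_scores_le:
  assumes "1 \<le> n" "1 \<le> d" "1 \<le> K"
  shows "card (scores n d K pY \<mu> L) \<le> 5 * K * d * n"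
proof -
  have "card (label_groups K) \<le> Suc (card ((\<lambda>k. {k}) ` {1..K}))"
    unfolding label_groups_def by (rule card_insert_le_m1) auto
  also have "\<dots> \<le> K + 1"
    using card_image_le[of "{1..K}" "\<lambda>k. {k}"] by simp
  finally have G: "card (label_groups K) \<le> K + 1" .
  have "card (scores n d K pY \<mu> L) \<le> card {1..K} + card (label_groups K \<times> {..<d} \<times> {1..n} \<times> {1, -1 :: real})"
    unfolding scores_def
    by (intro order_trans[OF card_Un_le] add_mono card_image_le) (auto simp: label_groups_def)
  also have "\<dots> = K + card (label_groups K) * (d * (n * 2))"
    by (simp add: card_cartesian_product)
  also have "\<dots> \<le> K + (K + 1) * (d * (n * 2))"
    using G by (intro add_left_mono mult_right_mono) auto
  \<comment> \<open>Rounding \<open>K\<close> up to \<open>K * d * n\<close> and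
    \<open>K + 1\<close> up to \<open>2 * K\<close> produces the factor 5.\<close>
  also have "\<dots> \<le> K * (d * n) + (K + K) * (d * (n * 2))"
    using assms by (intro add_mono mult_right_mono) auto
  finally show ?thesis by (simp add: algebra_simps)
qed

lemma scores_measurable:
  assumes "g \<in> scores n d K pY \<mu> L"
  shows "g \<in> borel_measurable (joint_law d K pY p)"
proof -
  from assms consider k where "g = count_score pY k"
    | G j t where "j < d" "g = noise_score \<mu> G j t"
    unfolding scores_def by fast
  then show ?thesis
    by cases (simp_all only: measurable_count_score measurable_noise_score)
qed

lemma nn_integral_exp_scores:
  assumes "set_pmf pY \<subseteq> {1..K}" "g \<in> scores n d K pY \<mu> L"
  shows "(\<integral>\<^sup>+z. ennreal (exp (g z)) \<partial>joint_law d K pY (\<lambda>x k. normal_Rn d (\<mu> k) x)) \<le> 1"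
proof -
  from assms(2) consider k where "k \<in> {1..K}" "g = count_score pY k"
    | G j t where "j < d" "g = noise_score \<mu> G j t"
    unfolding scores_def by fast
  then show ?thesis
    by cases (simp_all only: nn_integral_exp_count_score[OF assms(1)] nn_integral_exp_noise_score[OF assms(1)])
qed

text \<open>Each of the five factors 5, \<open>K\<close>, \<open>d\<close>, \<open>n\<close> and
  \<open>1 / \<delta>\<close> is at most the argument of the logarithm on the right, so their
  product is at most its fifth power.\<close>

lemma ln_union_bound_le:
  assumes "1 \<le> n" "1 \<le> d" "1 \<le> K" "0 < B" and \<delta>: "0 < \<delta>" "\<delta> \<le> 1/2"
  shows "ln (real (5 * K * d * n) / \<delta>) \<le> 5 * ln (2 + real n + real K + real d + B + 1 / \<delta>)"
proof -
  define Q where "Q = 2 + real n + real K + real d + B + 1 / \<delta>"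
  have inv: "1 / \<delta> \<ge> 2" using assms by (simp add: field_simps)
  have Q: "5 \<le> Q" "real K \<le> Q" "real d \<le> Q" "real n \<le> Q" "1 / \<delta> \<le> Q"
    using assms inv unfolding Q_def by auto
  have "real (5 * K * d * n) / \<delta> = 5 * real K * real d * real n * (1 / \<delta>)" by simp
  also have "\<dots> \<le> Q * Q * Q * Q * Q"
    using Q \<delta> by (intro mult_mono) auto
  also have "\<dots> = Q ^ 5" by algebra
  finally have "ln (real (5 * K * d * n) / \<delta>) \<le> ln (Q ^ 5)"
    using assms Q by (intro ln_mono) (auto intro!: divide_pos_pos)
  also have "\<dots> = 5 * ln Q" using Q by (simp add: ln_realpow)
  finally show ?thesis unfolding Q_def .
qed

section \<open>Error of the maximum likelihood estimator on the good event\<close>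

text \<open>Purely deterministic: the sample \<open>S\<close> is fixed, and all that probability has
  to supply is that every score sum stays below \<open>L\<close>.\<close>

lemma avg_TV_error_multi_le:
  assumes d: "1 \<le> d" and d1: "d1 \<le> d" and K: "1 \<le> K" and n: "1 \<le> n" and L: "0 < L"
    and pY: "set_pmf pY \<subseteq> {1..K}"
    and \<phi>s: "\<And>k. k \<in> {1..K} \<Longrightarrow> \<phi>s k \<in> box_Rn d1 B" and \<psi>s: "\<psi>s \<in> box_Rn (d - d1) B"
    and labels: "\<And>i. i < n \<Longrightarrow> snd (S i) \<in> {1..K}"
    and mle: "is_arg_max (likelihood n S) (\<lambda>p. p \<in> P_multi d d1 K B) p"
    and score: "\<And>g. g \<in> scores n d K pY (\<lambda>k. concat_vec d1 (\<phi>s k) \<psi>s) L \<Longrightarrow> (\<Sum>i<n. g (S i)) < L"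
  shows "(avg_TV_error d pY p (\<lambda>x k. gauss_density d d1 (\<phi>s k) \<psi>s x))\<^sup>2
    \<le> 6 * L * (((real K - 1) * real d1 + real d) / real n)"
proof -
  define \<mu> where "\<mu> k = concat_vec d1 (\<phi>s k) \<psi>s" for k
  \<comment> \<open>The truth must compete within \<open>P_multi\<close>, so it is rewritten in
    product form. Both forms agree on \<open>{1..K}\<close>, which contains the sample labels and
    the support of \<open>pY\<close>.\<close>
  define q where "q x y = (\<Prod>k\<in>{1..K}. gauss_density d d1 (\<phi>s k) \<psi>s x ^ of_bool (y = k))" for x y
  have q_in: "q \<in> P_multi d d1 K B"
    unfolding P_multi_def q_def using \<phi>s \<psi>s by blast
  have q: "q x k = normal_Rn d (\<mu> k) x" if "k \<in> {1..K}" for k x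
    unfolding q_def prod_power_of_bool[OF that] by (simp add: gauss_density_eq_normal_Rn \<mu>_def)
  from mle obtain \<phi> \<psi> where
    p_eq: "p = (\<lambda>x y. \<Prod>k\<in>{1..K}. gauss_density d d1 (\<phi> k) \<psi> x ^ of_bool (y = k))"
    unfolding is_arg_max_def P_multi_def by blast
  define \<nu> where "\<nu> k = concat_vec d1 (\<phi> k) \<psi>" for k
  have p: "p x k = normal_Rn d (\<nu> k) x" if "k \<in> {1..K}" for k x
    unfolding p_eq prod_power_of_bool[OF that] by (simp add: gauss_density_eq_normal_Rn \<nu>_def)
  have "likelihood n S q \<le> likelihood n S p"
    using mle q_in unfolding is_arg_max_def by (meson not_le)
  note ls = sum_squares_le_of_likelihood_le[OF labels p q this]
  have common: "\<nu> k j - \<mu> k j = \<nu> l j - \<mu> l j" if "d1 \<le> j" for k l j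
    using that by (simp add: \<nu>_def \<mu>_def concat_vec_def)
  have noise: "(\<Sum>i | i < n \<and> snd (S i) \<in> G. fst (S i) j - \<mu> (snd (S i)) j)\<^sup>2
      \<le> 2 * L * real (card {i. i < n \<and> snd (S i) \<in> G})"
    if "G \<in> insert {1..K} ((\<lambda>k. {k}) ` {1..K})" "j < d" for G j
  proof (rule square_sum_noise_le[OF L])
    fix m :: nat and \<sigma> :: real assume "m \<in> {1..n}" "\<sigma> \<in> {1, -1}"
    with that have "(G, j, m, \<sigma>) \<in> label_groups K \<times> {..<d} \<times> {1..n} \<times> {1, -1}"
      unfolding label_groups_def by blast
    then have "noise_score \<mu> G j (\<sigma> * sqrt (2 * L / real m)) \<in> scores n d K pY \<mu> L"
      unfolding scores_def by (intro UnI2 image_eqI[of _ _ "(G, j, m, \<sigma>)"]) auto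
    then show "(\<Sum>i<n. noise_score \<mu> G j (\<sigma> * sqrt (2 * L / real m)) (S i)) < L"
      using score unfolding \<mu>_def[abs_def] by blast
  qed
  have const: "(\<Sum>j<d. (\<nu> k j - \<mu> k j)\<^sup>2) = (\<Sum>j<d. (\<nu> 1 j - \<mu> 1 j)\<^sup>2)" if "d1 = 0" for k
    by (intro sum.cong refl arg_cong[of _ _ "\<lambda>x. x\<^sup>2"] common) (simp add: that)
  have dev: "(\<Sum>k\<in>{1..K}. real (card {i. i < n \<and> snd (S i) = k}) * (\<Sum>j<d. (\<nu> k j - \<mu> k j)\<^sup>2))
      \<le> 8 * L * ((real K - 1) * real d1 + real d)"
    by (rule least_squares_deviation[OF labels K d1 _ ls common noise]) (use L in auto)
  have counts: "real n * (pmf pY k / 2) - real (card {i. i < n \<and> snd (S i) = k}) \<le> L"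
    if "k \<in> {1..K}" for k
    using score[of "count_score pY k"] that unfolding scores_def sum_count_score
    by (intro less_imp_le) blast
  have c: "(\<Sum>k\<in>{1..K}. card {i. i < n \<and> snd (S i) = k}) = n"
    using sum_by_label[OF labels, where f = "\<lambda>_. 1"] by (simp flip: of_nat_sum)
  have "(avg_TV_error d pY p (\<lambda>x k. gauss_density d d1 (\<phi>s k) \<psi>s x))\<^sup>2
      \<le> (\<Sum>k\<in>{1..K}. pmf pY k * min 1 ((\<Sum>j<d. (\<nu> k j - \<mu> k j)\<^sup>2) / 4))"
    by (rule avg_TV_error_normal_square_le[OF pY p])
      (simp_all add: gauss_density_eq_normal_Rn \<mu>_def)
  also have "\<dots> \<le> 6 * L * (((real K - 1) * real d1 + real d) / real n)"
    by (rule weighted_truncated_sum_le[OF pY n _ d K c _ counts dev])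
      (use L in \<open>auto intro: sum_nonneg const\<close>)
  finally show ?thesis .
qed

theorem theorem4p1:
  "\<exists>C>0. \<exists>c>0.
     \<forall>(d::nat) (d1::nat) (K::nat) (n::nat) (B::real) (\<delta>::real) (pY::nat pmf)
       (\<phi>s::nat \<Rightarrow> nat \<Rightarrow> real) (\<psi>s::nat \<Rightarrow> real) (p_true::cond_density)
       (p_hat::(nat \<Rightarrow> (nat \<Rightarrow> real) \<times> nat) \<Rightarrow> cond_density).
       1 \<le> d \<longrightarrow> d1 \<le> d \<longrightarrow> 1 \<le> K \<longrightarrow> 1 \<le> n \<longrightarrow> 0 < B \<longrightarrow> 0 < \<delta> \<longrightarrow> \<delta> \<le> 1/2 \<longrightarrow>
       set_pmf pY \<subseteq> {1..K} \<longrightarrow>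
       (\<forall>k\<in>{1..K}. \<phi>s k \<in> box_Rn d1 B) \<longrightarrow> \<psi>s \<in> box_Rn (d - d1) B \<longrightarrow>
       p_true = (\<lambda>x k. gauss_density d d1 (\<phi>s k) \<psi>s x) \<longrightarrow>
       (\<forall>S\<in>space (sample_law n d K pY p_true).
          is_arg_max (likelihood n S) (\<lambda>p. p \<in> P_multi d d1 K B) (p_hat S)) \<longrightarrow>
       (\<exists>E\<in>sets (sample_law n d K pY p_true).
          measure (sample_law n d K pY p_true) E \<ge> 1 - \<delta> \<and>
          (\<forall>S\<in>E. avg_TV_error d pY (p_hat S) p_true
             \<le> C * sqrt (((real K - 1) * real d1 + real d) / real n) *
               ln (2 + real n + real K + real d + B + 1 / \<delta>) powr c))"
proof (rule exI[of _ 6], rule conjI, simp, rule exI[of _ "1/2"], rule conjI, simp, intro allI impI)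
  fix d d1 K n :: nat and B \<delta> :: real and pY :: "nat pmf"
    and \<phi>s :: "nat \<Rightarrow> nat \<Rightarrow> real" and \<psi>s :: "nat \<Rightarrow> real" and p_true :: cond_density
    and p_hat :: "(nat \<Rightarrow> (nat \<Rightarrow> real) \<times> nat) \<Rightarrow> cond_density"
  assume d: "1 \<le> d" and d1: "d1 \<le> d" and K: "1 \<le> K" and n: "1 \<le> n" and B: "0 < B"
    and \<delta>: "0 < \<delta>" "\<delta> \<le> 1/2" and pY: "set_pmf pY \<subseteq> {1..K}"
    and \<phi>s: "\<forall>k\<in>{1..K}. \<phi>s k \<in> box_Rn d1 B" and \<psi>s: "\<psi>s \<in> box_Rn (d - d1) B"
    and p_true: "p_true = (\<lambda>x k. gauss_density d d1 (\<phi>s k) \<psi>s x)"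
    and mle: "\<forall>S\<in>space (sample_law n d K pY p_true).
      is_arg_max (likelihood n S) (\<lambda>p. p \<in> P_multi d d1 K B) (p_hat S)"
  define \<mu> where "\<mu> k = concat_vec d1 (\<phi>s k) \<psi>s" for k
  define N where "N = real (5 * K * d * n)"
  \<comment> \<open>Chosen so that \<open>N * exp (- L) = \<delta>\<close>, where \<open>N\<close>
    bounds the number of scores.\<close>
  define L where "L = ln (N / \<delta>)"
  define Q where "Q = 2 + real n + real K + real d + B + 1 / \<delta>"
  define D where "D = (real K - 1) * real d1 + real d"
  define F where "F = scores n d K pY \<mu> L"
  define P where "P = sample_law n d K pY p_true"
  \<comment> \<open>The event refers to finitely many measurable scores only, so it is measurable
    whichever maximizers \<open>p_hat\<close> selects.\<close>
  define E where "E = {S \<in> space P. \<forall>g\<in>F. (\<Sum>i<n. g (S i)) < L}"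
  have N: "1 \<le> N"
    unfolding N_def using K d n by (metis One_nat_def Suc_leI mult_pos_pos of_nat_1 of_nat_le_iff
        order_less_le_trans zero_less_one zero_less_numeral)
  have "1 < N / \<delta>" using N \<delta> by (simp add: field_simps)
  then have L: "0 < L" by (simp add: L_def)
  have LQ: "L \<le> 5 * ln Q"
    unfolding L_def N_def Q_def by (rule ln_union_bound_le[OF n d K B \<delta>])
  have law: "p_true = (\<lambda>x k. normal_Rn d (\<mu> k) x)"
    by (simp add: p_true gauss_density_eq_normal_Rn \<mu>_def)
  note M = prob_space_joint_normal[OF pY, of d \<mu>, folded law]
  note I = nn_integral_exp_scores[OF pY, where n = n and d = d and \<mu> = \<mu> and L = L, folded law F_def]
  have P: "P = PiM {..<n} (\<lambda>_. joint_law d K pY p_true)"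
    by (simp add: P_def sample_law_def)
  have F: "finite F" "\<And>g. g \<in> F \<Longrightarrow> g \<in> borel_measurable (joint_law d K pY p_true)"
    unfolding F_def by (auto intro: finite_scores scores_measurable)
  have E: "E \<in> sets P" "1 - real (card F) * exp (- L) \<le> measure P E"
    using prob_all_scores_less[OF M F I, where n = n and L = L] unfolding E_def P by auto
  have "real (card F) * exp (- L) \<le> N * exp (- L)"
    unfolding F_def N_def using card_scores_le[OF n d K, of pY \<mu> L]
    by (intro mult_right_mono of_nat_mono) auto
  also have "\<dots> = \<delta>" using N \<delta> by (simp add: L_def exp_minus)
  finally have prob: "1 - \<delta> \<le> measure P E" using E(2) by linarith
  have bound: "avg_TV_error d pY (p_hat S) p_true \<le> 6 * sqrt (D / real n) * ln Q powr (1/2)"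
    if S: "S \<in> E" for S
  proof -
    have SP: "S \<in> space P" using S by (simp add: E_def)
    \<comment> \<open>This holds at every point of the sample space and not just almost surely,
      since the label component of that space is \<open>{1..K}\<close>.\<close>
    have labels: "snd (S i) \<in> {1..K}" if "i < n" for i
    proof -
      have "S i \<in> space (joint_law d K pY p_true)"
        using SP that unfolding P space_PiM by (auto simp: PiE_iff)
      also have "\<dots> = space (lebesgue_Rn d) \<times> {1..K}"
        by (subst sets_eq_imp_space_eq[OF sets_joint_law]) (simp add: space_pair_measure)
      finally show ?thesis by auto
    qed
    have D0: "0 \<le> D" using K by (simp add: D_def)
    have Q1: "0 \<le> ln Q" using L LQ by linarith
    have "(avg_TV_error d pY (p_hat S) p_true)\<^sup>2 \<le> 6 * L * (D / real n)"
      unfolding p_true D_def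
    proof (rule avg_TV_error_multi_le[OF d d1 K n L pY _ \<psi>s labels])
      show "is_arg_max (likelihood n S) (\<lambda>p. p \<in> P_multi d d1 K B) (p_hat S)"
        using mle SP unfolding P_def by blast
      show "(\<Sum>i<n. g (S i)) < L" if "g \<in> scores n d K pY (\<lambda>k. concat_vec d1 (\<phi>s k) \<psi>s) L" for g
        using S that unfolding E_def F_def \<mu>_def[abs_def] by blast
    qed (use \<phi>s in auto)
    \<comment> \<open>From \<open>L \<le> 5 * ln Q\<close> the factor is 30, rounded up to the
      square 36. Taking roots gives the constant 6 and the exponent \<open>1/2\<close> of the
      logarithm.\<close>
    also have "\<dots> \<le> 36 * ln Q * (D / real n)"
      using LQ Q1 D0 by (intro mult_right_mono) auto
    also have "\<dots> = (6 * sqrt (D / real n) * ln Q powr (1/2))\<^sup>2"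
      using Q1 D0 by (simp add: powr_half_sqrt power_mult_distrib)
    finally show ?thesis
      by (rule power2_le_imp_le) (use D0 in auto)
  qed
  show "\<exists>E\<in>sets (sample_law n d K pY p_true).
      measure (sample_law n d K pY p_true) E \<ge> 1 - \<delta> \<and>
      (\<forall>S\<in>E. avg_TV_error d pY (p_hat S) p_true
         \<le> 6 * sqrt (((real K - 1) * real d1 + real d) / real n) *
           ln (2 + real n + real K + real d + B + 1 / \<delta>) powr (1/2))"
    using E(1) prob bound unfolding P_def D_def Q_def by (intro bexI[of _ E]) auto
qed

end
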